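(* Let $m\ge 2$, $n,\ell\ge 1$ be integers, let $\Omega:\mathbb{R}^n\rightrightarrows\mathbb{R}^\ell$ be a set-valued mapping with nonempty closed values, for each $\omega\in\mathbb{R}^\ell$ let $\mathcal{B}(\omega)$ be a real tensor of order $m$ and dimension $n$, and let $p:\mathbb{R}^\ell\to\mathbb{R}^n$ be a mapping. Suppose there exists a compact set $K\subset\mathbb{R}^\ell$ such that $\Omega(v)\subset K$ for all $v\in\mathbb{R}^n$ and such that $p$ and $\omega\mapsto\mathcal{B}(\omega)$ are continuous on $K$. If the merit function $$r(v)=\min_{\omega\in\Omega(v)}\big\|\min\{v,\ \mathcal{B}(\omega)v^{m-1}+p(\omega)\}\big\|,\qquad v\in\mathbb{R}^n,$$ is level bounded, then for every $v\in\mathbb{R}^n$ the following implication holds: $$v\ge 0,\ \ \mathcal{B}(\omega)v^{m-1}\ge 0,\ \ \mathcal{B}(\omega)v^m=0\ \text{ for some }\ \omega\in\bigcap_{\bar N\in N_\infty}\ \bigcup_{k\in\bar N}\Omega(kv)\quad\Longrightarrow\quad v=0.$$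
   Context: A real tensor of order $m$ and dimension $n$ is an array $\mathcal{B}=(b_{i_1\ldots i_m})$ of real numbers with $i_j\in\{1,\ldots,n\}$; continuity of $\mathcal{B}(\omega)$ means continuity of every entry. For $v\in\mathbb{R}^n$, $\mathcal{B}v^{m-1}\in\mathbb{R}^n$ is the vector with components $(\mathcal{B}v^{m-1})_i=\sum_{i_2,\ldots,i_m=1}^n b_{i i_2\ldots i_m}v_{i_2}\cdots v_{i_m}$, and $\mathcal{B}v^m=v^T\mathcal{B}v^{m-1}\in\mathbb{R}$. Vector inequalities and the minimum of two vectors are componentwise; $\|\cdot\|$ is the Euclidean norm. A set-valued mapping $\Omega:\mathbb{R}^n\rightrightarrows\mathbb{R}^\ell$ assigns to each $v\in\mathbb{R}^n$ a subset $\Omega(v)\subseteq\mathbb{R}^\ell$. $N_\infty=\bigcup_{j=1}^\infty\{\{j,j+1,\ldots\}\}$ is the collection of all tails of the positive integers. A function $f:\mathbb{R}^n\to\mathbb{R}$ is level bounded if for every $\alpha\ge 0$ the level set $\{v\in\mathbb{R}^n:f(v)\le\alpha\}$ is bounded. *)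

theory Defs
  imports "HOL-Analysis.Analysis"
begin

text \<open>
  A real tensor of order \<open>m\<close> and dimension \<open>CARD('n)\<close> is an array of reals indexed by lists
  \<open>[i\<^sub>1, \<dots>, i\<^sub>m]\<close> over the finite index type \<open>'n\<close>. The order is passed separately; entries
  at lists whose length is not \<open>m\<close> are never read.
\<close>

type_synonym 'n tensor = "'n list \<Rightarrow> real"

definition continuous_on_tensor ::
    "nat \<Rightarrow> 'a::topological_space set \<Rightarrow> ('a \<Rightarrow> 'n tensor) \<Rightarrow> bool" where
  "continuous_on_tensor m K \<B> \<longleftrightarrow>
     (\<forall>is. length is = m \<longrightarrow> continuous_on K (\<lambda>\<omega>. \<B> \<omega> is))"

text \<open>\<open>\<B>v\<^bsup>m-1\<^esup>\<close>: the list \<open>js\<close> is \<open>[i\<^sub>2, \<dots>, i\<^sub>m]\<close>.\<close>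

definition tensor_apply :: "nat \<Rightarrow> 'n tensor \<Rightarrow> real ^ 'n \<Rightarrow> real ^ 'n::finite" where
  "tensor_apply m B v =
     (\<chi> i. \<Sum>js | length js = m - 1. B (i # js) * (\<Prod>j\<leftarrow>js. v $ j))"

text \<open>\<open>\<B>v\<^sup>m\<close>\<close>

definition tensor_form :: "nat \<Rightarrow> 'n tensor \<Rightarrow> real ^ 'n::finite \<Rightarrow> real" where
  "tensor_form m B v = v \<bullet> tensor_apply m B v"

text \<open>
  The componentwise minimum on \<open>real ^ 'n\<close> is \<open>inf\<close>, not \<open>min\<close>, since the componentwise
  order is not linear. The minimum over \<open>\<Omega> v\<close> is the least element of the set of values; it
  exists when \<open>\<Omega> v\<close> is nonempty and compact and the data are continuous on it.
\<close>

definition merit ::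
    "nat \<Rightarrow> (real ^ 'n::finite \<Rightarrow> 'a set) \<Rightarrow> ('a \<Rightarrow> 'n tensor) \<Rightarrow> ('a \<Rightarrow> real ^ 'n)
      \<Rightarrow> real ^ 'n \<Rightarrow> real" where
  "merit m \<Omega> \<B> p v =
     (LEAST y. y \<in> (\<lambda>\<omega>. norm (inf v (tensor_apply m (\<B> \<omega>) v + p \<omega>))) ` \<Omega> v)"

definition level_bounded :: "('a::metric_space \<Rightarrow> real) \<Rightarrow> bool" where
  "level_bounded f \<longleftrightarrow> (\<forall>\<alpha>\<ge>0. bounded {v. f v \<le> \<alpha>})"

definition N_infty :: "nat set set" where
  "N_infty = (\<Union>j\<in>{1..}. {{j..}})"

end

theory Submission
  imports Defs
begin

text \<open>
  Suppose \<open>v \<noteq> 0\<close> satisfies the premises with \<open>\<omega>\<close>. Then \<open>\<omega> \<in> \<Omega> (k v)\<close> for infinitely many \<open>k\<close>, and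
  \<open>v\<close> is complementary to \<open>\<B>(\<omega>)v\<^bsup>m-1\<^esup>\<close>, hence \<open>kv\<close> is complementary to \<open>\<B>(\<omega>)(kv)\<^bsup>m-1\<^esup>\<close>. Adding
  \<open>p(\<omega>)\<close> to the latter perturbs the componentwise minimum, which is \<open>0\<close>, by at most \<open>|p(\<omega>)|\<close>, so
  the merit function is at most \<open>\<parallel>p(\<omega>)\<parallel>\<close> on an unbounded set.
\<close>

lemma inf_vec_nth: "inf x y $ i = min (x $ i) (y $ i)" for x y :: "real ^ 'n::finite"
  by (simp add: inf_vec_def inf_min)

lemma tensor_apply_scaleR:
  "tensor_apply m B (c *\<^sub>R v) = c ^ (m - 1) *\<^sub>R tensor_apply m B v"
proof -
  have "(\<Prod>j\<leftarrow>js. (c *\<^sub>R v) $ j) = c ^ length js * (\<Prod>j\<leftarrow>js. v $ j)" for js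
    by (induction js) auto
  then show ?thesis
    by (simp add: tensor_apply_def vec_eq_iff sum_distrib_left mult.left_commute)
qed

text \<open>Each entry is a finite sum of tensor entries times constants. The bound on
  \<open>m\<close> excludes truncated subtraction in \<open>m - 1\<close>, so every
  \<open>i # js\<close> has length exactly \<open>m\<close>.\<close>

lemma continuous_on_tensor_apply:
  assumes "m \<ge> 1" and "continuous_on_tensor m K \<B>"
  shows "continuous_on K (\<lambda>\<omega>. tensor_apply m (\<B> \<omega>) v)"
  using assms unfolding tensor_apply_def continuous_on_tensor_def
  by (intro continuous_on_vec_lambda continuous_on_sum continuous_on_mult continuous_on_const) auto

text \<open>By compactness the minimum is attained, so the \<open>LEAST\<close> in
  \<open>merit\<close> denotes a genuine minimum.\<close>

lemma merit_le:
  fixes \<Omega> :: "real ^ 'n::finite \<Rightarrow> 'a::topological_space set"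
  assumes "m \<ge> 1" and "compact (\<Omega> v)"
    and "continuous_on (\<Omega> v) p" and "continuous_on_tensor m (\<Omega> v) \<B>" and "\<omega> \<in> \<Omega> v"
  shows "merit m \<Omega> \<B> p v \<le> norm (inf v (tensor_apply m (\<B> \<omega>) v + p \<omega>))"
proof -
  let ?f = "\<lambda>\<omega>. norm (inf v (tensor_apply m (\<B> \<omega>) v + p \<omega>))"
  have inf_eq: "inf v x = (\<chi> i. min (v $ i) (x $ i))" for x
    by (simp add: vec_eq_iff inf_vec_nth)
  have cont: "continuous_on (\<Omega> v) ?f"
    unfolding inf_eq using assms
    by (intro continuous_intros continuous_on_vec_lambda continuous_on_min
        continuous_on_tensor_apply) auto
  obtain \<eta> where \<eta>: "\<eta> \<in> \<Omega> v" "\<And>\<zeta>. \<zeta> \<in> \<Omega> v \<Longrightarrow> ?f \<eta> \<le> ?f \<zeta>"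
    using continuous_attains_inf[OF assms(2) _ cont] assms(5) by (metis empty_iff)
  then have "merit m \<Omega> \<B> p v = ?f \<eta>"
    unfolding merit_def by (intro Least_equality) auto
  then show ?thesis
    using \<eta>(2)[OF assms(5)] by simp
qed

text \<open>In each component, \<open>x $ i\<close> or \<open>y $ i\<close> vanishes and the other
  is nonnegative, so the minimum lies between \<open>0\<close> and \<open>q $ i\<close>.\<close>

lemma norm_inf_complementary_le:
  fixes x y q :: "real ^ 'n::finite"
  assumes "0 \<le> x" and "0 \<le> y" and "x \<bullet> y = 0"
  shows "norm (inf x (y + q)) \<le> norm q"
proof (rule norm_le_componentwise_cart)
  fix i
  have nonneg: "0 \<le> x $ j" "0 \<le> y $ j" for j
    using assms(1,2) by (auto simp: less_eq_vec_def)
  have "(\<Sum>j\<in>UNIV. x $ j * y $ j) = 0"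
    using assms(3) by (simp add: inner_vec_def)
  then have "x $ i * y $ i = 0"
    using nonneg by (simp add: sum_nonneg_eq_0_iff)
  then have "x $ i = 0 \<or> y $ i = 0"
    by simp
  then show "norm (inf x (y + q) $ i) \<le> norm (q $ i)"
    using nonneg[of i] by (auto simp: inf_vec_nth min_def)
qed

theorem theorem3p7:
  fixes m :: nat
    and \<Omega> :: "real ^ 'n::finite \<Rightarrow> (real ^ 'l::finite) set"
    and \<B> :: "real ^ 'l \<Rightarrow> 'n tensor"
    and p :: "real ^ 'l \<Rightarrow> real ^ 'n"
  assumes "m \<ge> 2"
    and "\<And>v. \<Omega> v \<noteq> {}"
    and "\<And>v. closed (\<Omega> v)"
    and "\<exists>K. compact K \<and> (\<forall>v. \<Omega> v \<subseteq> K) \<and> continuous_on K p \<and> continuous_on_tensor m K \<B>"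
    and "level_bounded (merit m \<Omega> \<B> p)"
  shows "\<forall>v. (\<exists>\<omega> \<in> (\<Inter>N\<in>N_infty. \<Union>k\<in>N. \<Omega> (real k *\<^sub>R v)).
              0 \<le> v \<and> 0 \<le> tensor_apply m (\<B> \<omega>) v \<and> tensor_form m (\<B> \<omega>) v = 0)
            \<longrightarrow> v = 0"
proof (intro allI impI, elim bexE conjE, rule ccontr)
  fix v \<omega>
  assume \<omega>: "\<omega> \<in> (\<Inter>N\<in>N_infty. \<Union>k\<in>N. \<Omega> (real k *\<^sub>R v))"
    and v: "0 \<le> v" "0 \<le> tensor_apply m (\<B> \<omega>) v" "tensor_form m (\<B> \<omega>) v = 0" "v \<noteq> 0"
  obtain K where K: "compact K" "\<And>v. \<Omega> v \<subseteq> K" "continuous_on K p" "continuous_on_tensor m K \<B>"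
    using assms(4) by blast
  have merit_le_norm: "merit m \<Omega> \<B> p (real k *\<^sub>R v) \<le> norm (p \<omega>)"
    if "\<omega> \<in> \<Omega> (real k *\<^sub>R v)" for k
  proof -
    let ?u = "real k *\<^sub>R v"
    have "compact (\<Omega> ?u)"
      using compact_Int_closed[OF K(1) assms(3)] K(2) by (simp add: Int_absorb1)
    moreover have "continuous_on (\<Omega> ?u) p" "continuous_on_tensor m (\<Omega> ?u) \<B>"
      using K continuous_on_subset unfolding continuous_on_tensor_def by blast+
    ultimately have "merit m \<Omega> \<B> p ?u \<le> norm (inf ?u (tensor_apply m (\<B> \<omega>) ?u + p \<omega>))"
      using that assms(1) by (intro merit_le) auto
    \<comment> \<open>Scaling \<open>v\<close> by \<open>k\<close> multiplies the tensor image by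
      \<open>k ^ (m - 1)\<close>; both factors are nonnegative, so complementarity survives.\<close>
    also have "\<dots> \<le> norm (p \<omega>)"
      using v(1-3)
      by (intro norm_inf_complementary_le)
        (auto simp: tensor_apply_scaleR tensor_form_def less_eq_vec_def)
    finally show ?thesis .
  qed
  have "bounded {u. merit m \<Omega> \<B> p u \<le> norm (p \<omega>)}"
    using assms(5) by (simp add: level_bounded_def)
  then obtain M where M: "\<And>u. merit m \<Omega> \<B> p u \<le> norm (p \<omega>) \<Longrightarrow> norm u \<le> M"
    by (auto simp: bounded_iff)
  obtain j :: nat where j: "M / norm v < real j"
    using reals_Archimedean2 by blast
  \<comment> \<open>Tails in \<open>N_infty\<close> start at \<open>1\<close> or later, while
    \<open>j\<close> may be \<open>0\<close>; hence \<open>Suc j\<close>.\<close>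
  have "{Suc j..} \<in> N_infty"
    by (auto simp: N_infty_def)
  then obtain k where k: "k \<ge> Suc j" "\<omega> \<in> \<Omega> (real k *\<^sub>R v)"
    using \<omega> by blast
  have "M < real j * norm v"
    using j v(4) by (simp add: divide_less_eq)
  also have "\<dots> \<le> norm (real k *\<^sub>R v)"
    using k(1) by (simp add: mult_right_mono)
  finally show False
    using M[OF merit_le_norm[OF k(2)]] by simp
qed

end
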